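(* Let $V$ and $E$ be finite sets and let $G_1,G_2,\dots$ be variable-length graphs (all directed, or all undirected) with the same vertex set $V$, the same edge set $E$ and the same incidences, differing only in edge lengths. Suppose $E=E_1\sqcup E_2$ where for each $e\in E_1$ the length of $e$ in $G_i$ is independent of $i$, and for each $e\in E_2$ the length of $e$ in $G_i$ tends to infinity as $i\to\infty$. Let $G_\infty$ be the variable-length graph obtained from any $G_i$ by discarding the edges of $E_2$. Then $\lim_{i\to\infty}\lambda_1(G_i)=\lambda_1(G_\infty)$.
   Context: A variable-length graph (VLG) is a (directed or undirected, possibly with multiple edges and self-loops) graph with a positive integer length assigned to each edge. A walk is a sequence of edges traversed consecutively (in an undirected VLG an edge may be traversed in either direction), and its length is the sum of the lengths of its edges (with multiplicity). For a vertex $v$ and integer $k\ge1$ let $c_G(v,v;k)$ be the number of closed walks of length $k$ starting and ending at $v$. Define $\lambda_1(G)=\sup_{v,k}\,c_G(v,v;k)^{1/k}$ (taken to be $0$ if there are no closed walks); for strongly connected $G$ this equals $\limsup_k c_G(u,v;k)^{1/k}$ for any vertices $u,v$.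
   Formalization: Adds the assumption that if G_i has a closed walk then so does G_∞; without it the claim fails (a single loop in E_2: λ_1(G_i)=1 but λ_1(G_∞)=0), and only cases where the claim is false are excluded. *)

theory Defs
  imports Complex_Main "HOL-Library.Uprod"
begin

datatype 'v incidence =
    is_Directed: Directed 'v 'v  \<comment> \<open>tail, head\<close>
  | is_Undirected: Undirected "'v uprod"

fun endpoints :: "'v incidence \<Rightarrow> 'v set" where
  "endpoints (Directed u v) = {u, v}"
| "endpoints (Undirected P) = set_uprod P"

fun traversable :: "'v incidence \<Rightarrow> 'v \<Rightarrow> 'v \<Rightarrow> bool" where
  "traversable (Directed a b) u v \<longleftrightarrow> u = a \<and> v = b"
| "traversable (Undirected P) u v \<longleftrightarrow> P = Upair u v"

record ('v, 'e) vlg =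
  verts :: "'v set"
  edges :: "'e set"
  inc   :: "'e \<Rightarrow> 'v incidence"
  len   :: "'e \<Rightarrow> nat"

definition wf_vlg :: "('v, 'e) vlg \<Rightarrow> bool" where
  "wf_vlg G \<longleftrightarrow> (\<forall>e\<in>edges G. endpoints (inc G e) \<subseteq> verts G \<and> len G e > 0)"

definition directed_vlg :: "('v, 'e) vlg \<Rightarrow> bool" where
  "directed_vlg G \<longleftrightarrow> wf_vlg G \<and> (\<forall>e\<in>edges G. is_Directed (inc G e))"

definition undirected_vlg :: "('v, 'e) vlg \<Rightarrow> bool" where
  "undirected_vlg G \<longleftrightarrow> wf_vlg G \<and> (\<forall>e\<in>edges G. is_Undirected (inc G e))"

text \<open>
  A walk is its starting vertex together with its sequence of edges; these determine all the
  vertices visited.  In particular an undirected self-loop can be traversed in one way only.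
\<close>

fun walk :: "('v, 'e) vlg \<Rightarrow> 'v \<Rightarrow> 'e list \<Rightarrow> 'v \<Rightarrow> bool" where
  "walk G u [] v \<longleftrightarrow> u \<in> verts G \<and> u = v"
| "walk G u (e # es) v \<longleftrightarrow>
     u \<in> verts G \<and> e \<in> edges G \<and> (\<exists>w. traversable (inc G e) u w \<and> walk G w es v)"

definition walk_length :: "('v, 'e) vlg \<Rightarrow> 'e list \<Rightarrow> nat" where
  "walk_length G es = sum_list (map (len G) es)"

definition num_walks :: "('v, 'e) vlg \<Rightarrow> 'v \<Rightarrow> 'v \<Rightarrow> nat \<Rightarrow> nat" where
  "num_walks G u v k = card {es. walk G u es v \<and> walk_length G es = k}"

text \<open>
  The empty walk is excluded because only lengths at least 1 count.  Whether there is a closed walk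
  matters for limits: with any, \<open>lambda1\<close> is at least 1, with none it is 0.  For instance, a single
  vertex with one self-loop has \<open>lambda1\<close> equal to 1 however long the loop is, but 0 once the loop is
  discarded.
\<close>

definition has_closed_walk :: "('v, 'e) vlg \<Rightarrow> bool" where
  "has_closed_walk G \<longleftrightarrow> (\<exists>v\<in>verts G. \<exists>es. es \<noteq> [] \<and> walk G v es v)"

text \<open>
  Meant for graphs with finitely many edges: then \<open>num_walks G v v k \<le> card (edges G) ^ k\<close>, as all
  lengths are positive, so the supremum is over a bounded set.
\<close>

definition lambda1 :: "('v, 'e) vlg \<Rightarrow> real" where
  "lambda1 G =
     (if has_closed_walk G
      then Sup {root k (real (num_walks G v v k)) | v k. v \<in> verts G \<and> k \<ge> 1}
      else 0)"

definition discard_edges :: "'e set \<Rightarrow> ('v, 'e) vlg \<Rightarrow> ('v, 'e) vlg" where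
  "discard_edges F G = G\<lparr>edges := edges G - F\<rparr>"

end

theory Submission
  imports Defs
begin

text \<open>
  Write \<open>H\<close> for the graph without the long edges and \<open>\<lambda>\<close> for \<open>lambda1 H\<close>; the degenerate case aside,
  \<open>\<lambda> \<ge> 1\<close>. Since \<open>H\<close> is a subgraph of every \<open>G i\<close>, only \<open>lambda1 (G i) \<le> \<nu>\<close> for \<open>\<nu> > \<lambda>\<close> and
  large \<open>i\<close> is at stake. Splitting a walk of \<open>H\<close> at the last visit to its starting vertex, and
  inducting on the set of available vertices, bounds the number of all (also open) walks of
  length \<open>k\<close> in \<open>H\<close> by \<open>C * \<mu> ^ k\<close> for \<open>\<lambda> < \<mu> < \<nu>\<close>. Splitting a walk of \<open>G i\<close> at its first long edge,
  strong induction on \<open>k\<close> bounds their number in \<open>G i\<close> by \<open>2 * C * \<nu> ^ k\<close> as soon as all long edges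
  are long enough. Repeating a closed walk removes the constant: the number of closed walks at a
  vertex is supermultiplicative in \<open>k\<close>, so it is at most \<open>\<nu> ^ k\<close>.
\<close>

section \<open>Counting edge lists by total length\<close>

text \<open>Set and weight are separate arguments, so that closed walks, walks on fewer vertices and
  walks of a subgraph can all be counted with one weight.\<close>

definition slice :: "('e \<Rightarrow> nat) \<Rightarrow> 'e list set \<Rightarrow> nat \<Rightarrow> 'e list set" where
  "slice w X k = {es \<in> X. sum_list (map w es) = k}"

lemma length_le_weight:
  assumes "\<forall>e\<in>E. 0 < w e" and "set es \<subseteq> E"
  shows "length es \<le> sum_list (map w es)"
  using assms(2)
proof (induction es)
  case (Cons e es)
  then have "0 < w e" using assms(1) by auto
  with Cons show ?case by auto
qed simp

lemma slice_subset_lists: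
  assumes "\<forall>e\<in>E. 0 < w e" and "X \<subseteq> lists E"
  shows "slice w X k \<subseteq> {es. set es \<subseteq> E \<and> length es \<le> k}"
  using length_le_weight[OF assms(1)] assms(2) by (force simp: slice_def)

lemma finite_slice:
  assumes "finite E" "\<forall>e\<in>E. 0 < w e" "X \<subseteq> lists E"
  shows "finite (slice w X k)"
  using slice_subset_lists[OF assms(2,3)] finite_lists_length_le[OF assms(1)]
  by (rule finite_subset)

lemma sum_power_le: "(\<Sum>i\<le>k. n ^ i) \<le> (n + 1) ^ k" for n :: nat
proof (induction k)
  case (Suc k)
  have "n ^ Suc k \<le> n * (n + 1) ^ k" by (simp add: power_mono)
  then have "n ^ Suc k + (\<Sum>i\<le>k. n ^ i) \<le> n * (n + 1) ^ k + (n + 1) ^ k"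
    using Suc by (rule add_mono)
  then show ?case by (simp add: algebra_simps)
qed simp

text \<open>Too crude for the growth estimates; it serves to bound the set whose supremum is
  \<open>lambda1\<close>.\<close>

lemma card_slice_le:
  assumes "finite E" "\<forall>e\<in>E. 0 < w e" "X \<subseteq> lists E"
  shows "card (slice w X k) \<le> (card E + 1) ^ k"
proof -
  have "card (slice w X k) \<le> card {es. set es \<subseteq> E \<and> length es \<le> k}"
    by (rule card_mono[OF finite_lists_length_le[OF assms(1)] slice_subset_lists[OF assms(2,3)]])
  also have "\<dots> = (\<Sum>i\<le>k. card E ^ i)" by (rule card_lists_length_le[OF assms(1)])
  also have "\<dots> \<le> (card E + 1) ^ k" by (rule sum_power_le)
  finally show ?thesis .
qed

text \<open>A list outside \<open>Y\<close> is cut into \<open>p\<close>, \<open>e\<close>,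
  \<open>q\<close>. For given \<open>e\<close> and \<open>p\<close> of total length \<open>j\<close>
  there are at most \<open>a * b * \<beta> ^ (k - L) * (\<alpha> / \<beta>) ^ j\<close> choices, and
  \<open>\<alpha> < \<beta>\<close> makes the sum over \<open>j\<close> a convergent geometric
  series, so no further factor growing with \<open>k\<close> appears. The bound on \<open>B\<close>
  is asked only up to length \<open>k - L\<close>, which lets \<open>B\<close> be the very set under
  estimation in a strong induction on \<open>k\<close>.\<close>

lemma card_slice_concat:
  fixes \<alpha> \<beta> a b :: real
  assumes X: "X \<subseteq> Y \<union> {p @ e # q | p e q. p \<in> A \<and> e \<in> F \<and> q \<in> B}"
    and F: "finite F" "\<And>e. e \<in> F \<Longrightarrow> L \<le> w e"
    and fin: "\<And>m. finite (slice w Y m)" "\<And>m. finite (slice w A m)" "\<And>m. finite (slice w B m)"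
    and \<alpha>: "0 \<le> \<alpha>" "\<alpha> < \<beta>" "1 \<le> \<beta>" and ab: "0 \<le> a" "0 \<le> b"
    and A: "\<And>m. card (slice w A m) \<le> a * \<alpha> ^ m"
    and B: "\<And>m. m + L \<le> k \<Longrightarrow> card (slice w B m) \<le> b * \<beta> ^ m"
  shows "card (slice w X k) \<le> card (slice w Y k) + card F * a * b * (\<beta> / (\<beta> - \<alpha>)) * \<beta> ^ k / \<beta> ^ L"
proof -
  \<comment> \<open>The total length of \<open>p\<close> paired with the middle edge;
    \<open>j + w e \<le> k\<close> keeps the subtraction \<open>k - j - w e\<close> in
    \<open>P\<close> exact.\<close>
  define I where "I = {(j, e). j \<le> k \<and> e \<in> F \<and> j + w e \<le> k}"
  define P where "P = (\<lambda>(j, e). (\<lambda>(p, q). p @ e # q) ` (slice w A j \<times> slice w B (k - j - w e)))"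
  have subI: "I \<subseteq> {..k} \<times> F" by (auto simp: I_def)
  have finI: "finite I" using subI F(1) by (meson finite_SigmaI finite_atMost finite_subset)
  have finP: "finite (P i)" for i using fin by (auto simp: P_def split: prod.split)
  have sub: "slice w X k \<subseteq> slice w Y k \<union> (\<Union>i\<in>I. P i)"
  proof
    fix es assume "es \<in> slice w X k"
    then have es: "es \<in> X" "sum_list (map w es) = k" by (auto simp: slice_def)
    show "es \<in> slice w Y k \<union> (\<Union>i\<in>I. P i)"
    proof (cases "es \<in> Y")
      case False
      then obtain p e q where pq: "es = p @ e # q" "p \<in> A" "e \<in> F" "q \<in> B"
        using es(1) X by blast
      have "(sum_list (map w p), e) \<in> I" using pq es(2) by (auto simp: I_def)
      moreover have "es \<in> P (sum_list (map w p), e)"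
        using pq es(2) by (auto simp: P_def slice_def)
      ultimately show ?thesis by blast
    qed (use es in \<open>auto simp: slice_def\<close>)
  qed
  have cardP: "real (card (P (j, e))) \<le> a * b * \<beta> ^ k / \<beta> ^ L * (\<alpha> / \<beta>) ^ j" if "(j, e) \<in> I" for j e
  proof -
    have je: "j \<le> k" "e \<in> F" "j + w e \<le> k" "L \<le> w e" using that F(2) by (auto simp: I_def)
    have "card (P (j, e)) \<le> card (slice w A j \<times> slice w B (k - j - w e))"
      unfolding P_def prod.case using fin by (intro card_image_le) auto
    then have "real (card (P (j, e))) \<le> real (card (slice w A j)) * real (card (slice w B (k - j - w e)))"
      unfolding card_cartesian_product by (metis of_nat_le_iff of_nat_mult)
    also have "\<dots> \<le> (a * \<alpha> ^ j) * (b * \<beta> ^ (k - j - w e))"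
      using \<alpha> ab je by (intro mult_mono A B) auto
    \<comment> \<open>As \<open>1 \<le> \<beta>\<close>, replacing the length of \<open>e\<close> by
      its lower bound \<open>L\<close> only enlarges the estimate.\<close>
    also have "\<dots> \<le> (a * \<alpha> ^ j) * (b * \<beta> ^ (k - j - L))"
      using \<alpha> ab je by (intro mult_left_mono power_increasing) auto
    also have "\<beta> ^ (k - j - L) = \<beta> ^ k / \<beta> ^ L / \<beta> ^ j"
      using \<alpha> je by (simp add: power_diff power_add)
    finally show ?thesis using \<alpha> ab
      by (simp add: power_divide mult_ac)
  qed
  have geo: "(\<Sum>j\<le>k. (\<alpha> / \<beta>) ^ j) \<le> \<beta> / (\<beta> - \<alpha>)"
  proof -
    have "(\<lambda>j. (\<alpha> / \<beta>) ^ j) sums (1 / (1 - \<alpha> / \<beta>))"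
      using \<alpha> by (intro geometric_sums) auto
    then have "(\<Sum>j\<le>k. (\<alpha> / \<beta>) ^ j) \<le> 1 / (1 - \<alpha> / \<beta>)"
      using \<alpha> by (metis (no_types, lifting) sum_le_suminf finite_atMost sums_iff divide_nonneg_pos
        less_le_trans zero_less_one zero_le_power)
    also have "\<dots> = \<beta> / (\<beta> - \<alpha>)" using \<alpha> by (simp add: field_simps)
    finally show ?thesis .
  qed
  have "card (slice w X k) \<le> card (slice w Y k \<union> (\<Union>i\<in>I. P i))"
    using fin finI finP by (intro card_mono sub) auto
  also have "\<dots> \<le> card (slice w Y k) + card (\<Union>i\<in>I. P i)" by (rule card_Un_le)
  also have "card (\<Union>i\<in>I. P i) \<le> (\<Sum>i\<in>I. card (P i))" by (rule card_UN_le[OF finI])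
  finally have "real (card (slice w X k)) \<le> card (slice w Y k) + (\<Sum>i\<in>I. real (card (P i)))"
    by (simp flip: of_nat_sum of_nat_add)
  also have "(\<Sum>i\<in>I. real (card (P i))) \<le> (\<Sum>(j, e)\<in>I. a * b * \<beta> ^ k / \<beta> ^ L * (\<alpha> / \<beta>) ^ j)"
    by (rule sum_mono) (use cardP in auto)
  \<comment> \<open>The full rectangle adds only nonnegative terms and lets the sum factor.\<close>
  also have "\<dots> \<le> (\<Sum>(j, e)\<in>{..k} \<times> F. a * b * \<beta> ^ k / \<beta> ^ L * (\<alpha> / \<beta>) ^ j)"
    using subI F(1) \<alpha> ab by (intro sum_mono2) auto
  also have "\<dots> = card F * (a * b * \<beta> ^ k / \<beta> ^ L) * (\<Sum>j\<le>k. (\<alpha> / \<beta>) ^ j)"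
    by (simp add: sum.cartesian_product[symmetric] sum_distrib_left sum_divide_distrib mult_ac)
  also have "\<dots> \<le> card F * (a * b * \<beta> ^ k / \<beta> ^ L) * (\<beta> / (\<beta> - \<alpha>))"
    using \<alpha> ab by (intro mult_left_mono geo) auto
  finally show ?thesis by (simp add: mult_ac)
qed

section \<open>Walks as edge lists\<close>

definition walks_from :: "('v, 'e) vlg \<Rightarrow> 'v \<Rightarrow> 'e list set" where
  "walks_from G u = {es. \<exists>v. walk G u es v}"

text \<open>An edge list that is a walk from several vertices counts once. This is enough to
  dominate \<open>num_walks G v v k\<close>, where the starting vertex is fixed.\<close>

definition walks :: "('v, 'e) vlg \<Rightarrow> 'e list set" where
  "walks G = {es. \<exists>u v. walk G u es v}"

lemma walk_verts: "walk G u es v \<Longrightarrow> u \<in> verts G \<and> v \<in> verts G"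
  by (induction es arbitrary: u) auto

lemma walk_edges: "walk G u es v \<Longrightarrow> set es \<subseteq> edges G"
  by (induction es arbitrary: u) auto

lemma walk_append: "walk G u p v \<Longrightarrow> walk G v q x \<Longrightarrow> walk G u (p @ q) x"
  by (induction p arbitrary: u) auto

lemma walk_mono:
  assumes "verts H \<subseteq> verts G" "edges H \<subseteq> edges G" "\<And>e. e \<in> edges H \<Longrightarrow> inc H e = inc G e"
  shows "walk H u es v \<Longrightarrow> walk G u es v"
  using assms by (induction es arbitrary: u) auto

lemma walks_subset_lists: "walks G \<subseteq> lists (edges G)"
  using walk_edges by (fastforce simp: walks_def)

lemma closed_walks_subset_lists: "{es. walk G u es u} \<subseteq> lists (edges G)"
  using walk_edges by fastforce

lemma num_walks_slice: "num_walks G u v k = card (slice (len G) {es. walk G u es v} k)"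
  by (simp add: num_walks_def slice_def walk_length_def)

section \<open>From closed walks to all walks\<close>

text \<open>\<open>walk\<close> tests every visited vertex against \<open>verts\<close>, so
  shrinking \<open>verts\<close> to \<open>S - {u}\<close> already forbids \<open>u\<close>; the
  edges stay as they are. The induction strips the first edge, hence the arbitrary start
  \<open>x\<close> and the case in which \<open>u\<close> is never met.\<close>

lemma walk_last_visit:
  assumes "walk (G\<lparr>verts := S\<rparr>) x es v"
  shows "walk (G\<lparr>verts := S - {u}\<rparr>) x es v
    \<or> (walk (G\<lparr>verts := S\<rparr>) x es u)
    \<or> (\<exists>p e q. es = p @ e # q \<and> walk (G\<lparr>verts := S\<rparr>) x p u \<and> e \<in> edges G
          \<and> q \<in> walks (G\<lparr>verts := S - {u}\<rparr>))"
  using assms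
proof (induction es arbitrary: x)
  case (Cons e es)
  then obtain y where y: "traversable (inc G e) x y" "walk (G\<lparr>verts := S\<rparr>) y es v"
    and x: "x \<in> S" and e: "e \<in> edges G" by auto
  from Cons.IH[OF y(2)] consider
    (avoid) "walk (G\<lparr>verts := S - {u}\<rparr>) y es v"
    | (here) "walk (G\<lparr>verts := S\<rparr>) y es u"
    | (split) p e' q where "es = p @ e' # q" "walk (G\<lparr>verts := S\<rparr>) y p u" "e' \<in> edges G"
        "q \<in> walks (G\<lparr>verts := S - {u}\<rparr>)"
    by blast
  then show ?case
  proof cases
    case avoid
    show ?thesis
    proof (cases "x = u")
      case True
      \<comment> \<open>The walk begins at its last visit to \<open>u\<close>, so the prefix is
        empty.\<close>
      have "e # es = [] @ e # es \<and> walk (G\<lparr>verts := S\<rparr>) x [] u \<and> e \<in> edges G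
          \<and> es \<in> walks (G\<lparr>verts := S - {u}\<rparr>)"
        using True x e avoid by (auto simp: walks_def)
      then show ?thesis by blast
    qed (use avoid x e y in auto)
  next
    case here
    then show ?thesis using x e y by auto
  next
    case split
    then have "e # es = (e # p) @ e' # q \<and> walk (G\<lparr>verts := S\<rparr>) x (e # p) u \<and> e' \<in> edges G
          \<and> q \<in> walks (G\<lparr>verts := S - {u}\<rparr>)"
      using x e y by auto
    then show ?thesis by blast
  qed
qed auto

text \<open>A walk starting at \<open>u\<close> cannot avoid \<open>u\<close>, which leaves two of
  the three cases of the last visit.\<close>

lemma walks_from_decompose:
  "walks_from (G\<lparr>verts := S\<rparr>) u \<subseteq> {es. walk (G\<lparr>verts := S\<rparr>) u es u}
    \<union> {p @ e # q | p e q. p \<in> {es. walk (G\<lparr>verts := S\<rparr>) u es u} \<and> e \<in> edges G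
        \<and> q \<in> walks (G\<lparr>verts := S - {u}\<rparr>)}"
proof
  fix es assume "es \<in> walks_from (G\<lparr>verts := S\<rparr>) u"
  then obtain v where "walk (G\<lparr>verts := S\<rparr>) u es v" by (auto simp: walks_from_def)
  moreover have "\<not> walk (G\<lparr>verts := S - {u}\<rparr>) u es v"
    using walk_verts by force
  ultimately show "es \<in> {es. walk (G\<lparr>verts := S\<rparr>) u es u}
    \<union> {p @ e # q | p e q. p \<in> {es. walk (G\<lparr>verts := S\<rparr>) u es u} \<and> e \<in> edges G
        \<and> q \<in> walks (G\<lparr>verts := S - {u}\<rparr>)}"
    using walk_last_visit[where x = u and u = u] by blast
qed

text \<open>Up to its last visit to the starting vertex \<open>u\<close> a walk is closed at
  \<open>u\<close>; after it the walk lives on \<open>S - {u}\<close>, where the induction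
  hypothesis applies. Since the closed part grows with \<open>\<alpha>\<close> and the rest with
  \<open>\<beta>\<close>, the same \<open>\<beta>\<close> serves at every stage and only the
  constant changes.\<close>

lemma walks_growth_from_closed:
  fixes \<alpha> \<beta> :: real
  assumes "finite (edges G)" "\<forall>e\<in>edges G. 0 < len G e"
    and \<alpha>: "0 \<le> \<alpha>" "\<alpha> < \<beta>" "1 \<le> \<beta>"
    and closed: "\<And>v k. v \<in> verts G \<Longrightarrow> num_walks G v v k \<le> \<alpha> ^ k"
    and "finite S" "S \<subseteq> verts G"
  shows "\<exists>C\<ge>0. \<forall>k. card (slice (len G) (walks (G\<lparr>verts := S\<rparr>)) k) \<le> C * \<beta> ^ k"
  using assms(7,8)
proof (induction S rule: finite_psubset_induct)
  case (psubset S)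
  have fin: "finite (slice (len G) X k)" if "X \<subseteq> lists (edges G)" for X k
    using finite_slice[OF assms(1,2) that] .
  have fin_walks: "finite (slice (len G) (walks (G\<lparr>verts := T\<rparr>)) k)" for T k
    using fin walks_subset_lists[of "G\<lparr>verts := T\<rparr>"] by simp
  have fin_closed: "finite (slice (len G) {es. walk (G\<lparr>verts := T\<rparr>) u es u} k)" for T u k
    using fin closed_walks_subset_lists[of "G\<lparr>verts := T\<rparr>"] by simp
  have card_closed: "card (slice (len G) {es. walk (G\<lparr>verts := S\<rparr>) u es u} k) \<le> \<alpha> ^ k"
    if "u \<in> S" for u k
  proof -
    have "slice (len G) {es. walk (G\<lparr>verts := S\<rparr>) u es u} k \<subseteq> slice (len G) {es. walk G u es u} k"
      using walk_mono[of "G\<lparr>verts := S\<rparr>" G] psubset.prems by (auto simp: slice_def)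
    then have "card (slice (len G) {es. walk (G\<lparr>verts := S\<rparr>) u es u} k) \<le> num_walks G u u k"
      unfolding num_walks_slice by (intro card_mono fin closed_walks_subset_lists)
    then show ?thesis using closed[of u k] psubset.prems that by force
  qed
  have "\<exists>D\<ge>0. \<forall>k. card (slice (len G) (walks_from (G\<lparr>verts := S\<rparr>) u) k) \<le> D * \<beta> ^ k"
    if u: "u \<in> S" for u
  proof -
    have "S - {u} \<subset> S" "S - {u} \<subseteq> verts G" using u psubset.prems by auto
    from psubset.IH[OF this] obtain C where C: "C \<ge> 0"
      "\<And>k. card (slice (len G) (walks (G\<lparr>verts := S - {u}\<rparr>)) k) \<le> C * \<beta> ^ k" by blast
    \<comment> \<open>The \<open>1\<close> pays for the closed walks, through
      \<open>\<alpha> ^ k \<le> \<beta> ^ k\<close>; the rest is the concatenation bound with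
      \<open>a = 1\<close>, \<open>b = C\<close> and \<open>L = 0\<close>, no edge being assumed
      long here.\<close>
    define D where "D = 1 + card (edges G) * C * (\<beta> / (\<beta> - \<alpha>))"
    have "card (slice (len G) (walks_from (G\<lparr>verts := S\<rparr>) u) k) \<le> D * \<beta> ^ k" for k
    proof -
      have "card (slice (len G) (walks_from (G\<lparr>verts := S\<rparr>) u) k)
        \<le> card (slice (len G) {es. walk (G\<lparr>verts := S\<rparr>) u es u} k)
          + real (card (edges G)) * 1 * C * (\<beta> / (\<beta> - \<alpha>)) * \<beta> ^ k / \<beta> ^ 0"
        using fin_closed fin_walks card_closed[OF u] assms(1) \<alpha> C
        by (intro card_slice_concat[OF walks_from_decompose]) auto
      moreover have "\<alpha> ^ k \<le> \<beta> ^ k" using \<alpha> by (intro power_mono) auto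
      ultimately show ?thesis using card_closed[OF u, of k] by (simp add: D_def algebra_simps)
    qed
    moreover have "D \<ge> 0" using C \<alpha> by (simp add: D_def)
    ultimately show ?thesis by blast
  qed
  then obtain D where D: "\<And>u. u \<in> S \<Longrightarrow> D u \<ge> 0"
    "\<And>u k. u \<in> S \<Longrightarrow> card (slice (len G) (walks_from (G\<lparr>verts := S\<rparr>) u) k) \<le> D u * \<beta> ^ k"
    by metis
  have "card (slice (len G) (walks (G\<lparr>verts := S\<rparr>)) k) \<le> (\<Sum>u\<in>S. D u) * \<beta> ^ k" for k
  proof -
    have "slice (len G) (walks (G\<lparr>verts := S\<rparr>)) k
      = (\<Union>u\<in>S. slice (len G) (walks_from (G\<lparr>verts := S\<rparr>) u) k)"
      using walk_verts[of "G\<lparr>verts := S\<rparr>"] by (fastforce simp: slice_def walks_def walks_from_def)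
    then have "card (slice (len G) (walks (G\<lparr>verts := S\<rparr>)) k)
      \<le> (\<Sum>u\<in>S. card (slice (len G) (walks_from (G\<lparr>verts := S\<rparr>) u) k))"
      using card_UN_le[OF psubset.hyps(1)] by metis
    then have "real (card (slice (len G) (walks (G\<lparr>verts := S\<rparr>)) k))
      \<le> (\<Sum>u\<in>S. real (card (slice (len G) (walks_from (G\<lparr>verts := S\<rparr>) u) k)))"
      by (simp flip: of_nat_sum)
    also have "\<dots> \<le> (\<Sum>u\<in>S. D u * \<beta> ^ k)" by (intro sum_mono D)
    finally show ?thesis by (simp add: sum_distrib_right)
  qed
  moreover have "(\<Sum>u\<in>S. D u) \<ge> 0" by (intro sum_nonneg D)
  ultimately show ?case by blast
qed

section \<open>Putting the long edges back\<close>

text \<open>Cutting at the first edge of \<open>F\<close> puts the prefix into the smaller graph,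
  whose growth is known, and leaves an unrestricted suffix to an induction on the total
  length.\<close>

lemma walk_first_discarded:
  assumes "walk G u es v"
  shows "es \<in> walks (discard_edges F G)
    \<union> {p @ e # q | p e q. p \<in> walks (discard_edges F G) \<and> e \<in> F \<inter> edges G \<and> q \<in> walks G}"
proof -
  \<comment> \<open>\<open>walks\<close> forgets the starting vertex, which the induction needs in
    order to put an edge in front; hence the claim with \<open>u\<close> explicit.\<close>
  have "walk (discard_edges F G) u es v
    \<or> (\<exists>p e q x. es = p @ e # q \<and> walk (discard_edges F G) u p x \<and> e \<in> F \<inter> edges G \<and> q \<in> walks G)"
    using assms
  proof (induction es arbitrary: u)
    case (Cons e es)
    then obtain y where y: "traversable (inc G e) u y" "walk G y es v"
      and u: "u \<in> verts G" and e: "e \<in> edges G" by auto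
    show ?case
    proof (cases "e \<in> F")
      case True
      have "e # es = [] @ e # es \<and> walk (discard_edges F G) u [] u \<and> e \<in> F \<inter> edges G
          \<and> es \<in> walks G"
        using True u e y by (auto simp: walks_def discard_edges_def)
      then show ?thesis by blast
    next
      case False
      from Cons.IH[OF y(2)] consider
        (avoid) "walk (discard_edges F G) y es v"
        | (split) p e' q x where "es = p @ e' # q" "walk (discard_edges F G) y p x"
            "e' \<in> F \<inter> edges G" "q \<in> walks G"
        by blast
      then show ?thesis
      proof cases
        case avoid
        then show ?thesis using False u e y by (auto simp: discard_edges_def)
      next
        case split
        then have "e # es = (e # p) @ e' # q \<and> walk (discard_edges F G) u (e # p) x
            \<and> e' \<in> F \<inter> edges G \<and> q \<in> walks G"
          using False u e y by (auto simp: discard_edges_def)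
        then show ?thesis by blast
      qed
    qed
  qed (auto simp: discard_edges_def)
  then show ?thesis unfolding walks_def by blast
qed

text \<open>Walks avoiding \<open>F\<close> account for \<open>C * \<beta> ^ k\<close>, and the
  condition on \<open>L\<close> makes those meeting \<open>F\<close> account for at most as much
  again. \<open>0 < L\<close> makes the suffix strictly shorter, so that strong induction on
  \<open>k\<close> applies.\<close>

lemma walks_growth_from_discard:
  fixes \<alpha> \<beta> C :: real
  assumes "finite (edges G)" "\<forall>e\<in>edges G. 0 < len G e"
    and \<alpha>: "0 \<le> \<alpha>" "\<alpha> < \<beta>" "1 \<le> \<beta>" and C: "0 \<le> C"
    and short: "\<And>k. card (slice (len G) (walks (discard_edges F G)) k) \<le> C * \<alpha> ^ k"
    and long: "\<And>e. e \<in> F \<inter> edges G \<Longrightarrow> L \<le> len G e"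
    and L: "0 < L" "2 * (card (edges G) * C * (\<beta> / (\<beta> - \<alpha>))) \<le> \<beta> ^ L"
  shows "card (slice (len G) (walks G) k) \<le> 2 * C * \<beta> ^ k"
proof (induction k rule: less_induct)
  case (less k)
  have fin: "finite (slice (len G) (walks G) m)" for m
    by (intro finite_slice[OF assms(1,2)] walks_subset_lists)
  have fin': "finite (slice (len G) (walks (discard_edges F G)) m)" for m
    using walks_subset_lists[of "discard_edges F G"]
    by (intro finite_slice[OF assms(1,2)]) (auto simp: discard_edges_def)
  have "card (slice (len G) (walks G) k) \<le> card (slice (len G) (walks (discard_edges F G)) k)
      + card (F \<inter> edges G) * C * (2 * C) * (\<beta> / (\<beta> - \<alpha>)) * \<beta> ^ k / \<beta> ^ L"
  proof (rule card_slice_concat[where B = "walks G" and A = "walks (discard_edges F G)"])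
    show "walks G \<subseteq> walks (discard_edges F G) \<union> {p @ e # q | p e q.
      p \<in> walks (discard_edges F G) \<and> e \<in> F \<inter> edges G \<and> q \<in> walks G}"
    proof
      fix es assume "es \<in> walks G"
      then obtain u v where "walk G u es v" by (auto simp: walks_def)
      then show "es \<in> walks (discard_edges F G) \<union> {p @ e # q | p e q.
        p \<in> walks (discard_edges F G) \<and> e \<in> F \<inter> edges G \<and> q \<in> walks G}"
        by (rule walk_first_discarded)
    qed
    show "card (slice (len G) (walks G) m) \<le> 2 * C * \<beta> ^ m" if "m + L \<le> k" for m
      using that L(1) by (intro less.IH) auto
  qed (use fin fin' short long \<alpha> C assms(1) in auto)
  also have "card (F \<inter> edges G) * C * (2 * C) * (\<beta> / (\<beta> - \<alpha>)) * \<beta> ^ k / \<beta> ^ L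
    \<le> card (edges G) * C * (2 * C) * (\<beta> / (\<beta> - \<alpha>)) * \<beta> ^ k / \<beta> ^ L"
    using \<alpha> C assms(1)
    by (intro divide_right_mono mult_right_mono) (auto intro: card_mono)
  \<comment> \<open>Regrouped so that the quotient is at most 1 by the choice of \<open>L\<close>;
    its 2 comes from the inductive bound \<open>2 * C\<close>.\<close>
  also have "\<dots> = C * \<beta> ^ k * (2 * (card (edges G) * C * (\<beta> / (\<beta> - \<alpha>))) / \<beta> ^ L)"
    by simp
  also have "\<dots> \<le> C * \<beta> ^ k * 1"
    using \<alpha> C L(2) by (intro mult_left_mono) (auto simp: divide_le_eq mult_ac)
  also have "card (slice (len G) (walks (discard_edges F G)) k) \<le> C * \<beta> ^ k"
    using short[of k] \<alpha> C by (meson less_imp_le mult_left_mono order_trans power_mono)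
  finally show ?case by simp
qed

section \<open>Removing the constant\<close>

text \<open>Concatenation is injective on these pairs: two cuts of one list whose first parts both
  have total length \<open>j\<close> differ by a piece \<open>r\<close> of total length 0, which is
  empty because edge lengths are positive.\<close>

lemma num_walks_supermult:
  assumes "finite (edges G)" "\<forall>e\<in>edges G. 0 < len G e"
  shows "num_walks G v v j * num_walks G v v k \<le> num_walks G v v (j + k)"
proof -
  let ?S = "slice (len G) {es. walk G v es v}"
  have inj: "inj_on (\<lambda>(p, q). p @ q) (?S j \<times> ?S k)"
  proof (rule inj_onI, clarify)
    fix p q p' q' assume S: "p \<in> ?S j" "p' \<in> ?S j" "p @ q = p' @ q'"
    from S(3) obtain r where r: "p = p' @ r \<and> q' = r @ q \<or> p' = p @ r \<and> q = r @ q'"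
      by (auto simp: append_eq_append_conv2)
    have "sum_list (map (len G) p) = sum_list (map (len G) p')"
      using S(1,2) by (simp add: slice_def)
    then have r0: "sum_list (map (len G) r) = 0" using r by (elim disjE conjE) simp_all
    have "set r \<subseteq> edges G" using r S(1,2) walk_edges by (fastforce simp: slice_def)
    then have "length r \<le> sum_list (map (len G) r)" by (rule length_le_weight[OF assms(2)])
    then have "r = []" unfolding r0 by simp
    with r show "p = p' \<and> q = q'" by auto
  qed
  have "(\<lambda>(p, q). p @ q) ` (?S j \<times> ?S k) \<subseteq> ?S (j + k)"
    by (auto simp: slice_def intro: walk_append)
  moreover have "finite (?S (j + k))"
    by (intro finite_slice[OF assms] closed_walks_subset_lists)
  ultimately have "card (?S j \<times> ?S k) \<le> card (?S (j + k))"
    by (rule card_inj_on_le[OF inj])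
  then show ?thesis by (simp add: num_walks_slice card_cartesian_product)
qed

lemma num_walks_power_le:
  assumes "finite (edges G)" "\<forall>e\<in>edges G. 0 < len G e" "v \<in> verts G"
  shows "num_walks G v v k ^ m \<le> num_walks G v v (m * k)"
proof (induction m)
  case 0
  \<comment> \<open>The empty walk at \<open>v\<close> makes the count at length 0 positive, as the
    zeroth power demands.\<close>
  have "[] \<in> slice (len G) {es. walk G v es v} 0" using assms(3) by (simp add: slice_def)
  moreover have "finite (slice (len G) {es. walk G v es v} 0)"
    by (intro finite_slice[OF assms(1,2)] closed_walks_subset_lists)
  ultimately have "0 < num_walks G v v 0" unfolding num_walks_slice by (auto simp: card_gt_0_iff)
  then show ?case by simp
next
  case (Suc m)
  have "num_walks G v v k ^ Suc m \<le> num_walks G v v k * num_walks G v v (m * k)"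
    using Suc by simp
  also have "\<dots> \<le> num_walks G v v (Suc m * k)"
    using num_walks_supermult[OF assms(1,2), of v k "m * k"] by simp
  finally show ?case .
qed

text \<open>If \<open>x\<close> exceeded \<open>y\<close>, the powers of \<open>x / y\<close> would
  outgrow every constant \<open>K\<close>.\<close>

lemma le_if_powers_le:
  fixes x y K :: real
  assumes "0 < y" and "\<And>m. x ^ m \<le> K * y ^ m"
  shows "x \<le> y"
proof (rule ccontr)
  assume "\<not> x \<le> y"
  then have "1 < x / y" using assms(1) by simp
  then obtain m where "K < (x / y) ^ m" using real_arch_pow by blast
  then have "K * y ^ m < x ^ m" using assms(1) by (simp add: power_divide less_divide_eq)
  with assms(2)[of m] show False by simp
qed

text \<open>Concatenating closed walks of length \<open>k\<close>, \<open>m\<close> at a time,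
  bounds \<open>num_walks G v v k ^ m\<close> by \<open>K * (\<beta> ^ k) ^ m\<close>. With
  \<open>k\<close> fixed and \<open>m\<close> arbitrary, \<open>K\<close> disappears.\<close>

lemma num_closed_walks_le:
  fixes \<beta> K :: real
  assumes "finite (edges G)" "\<forall>e\<in>edges G. 0 < len G e" "v \<in> verts G" "0 < \<beta>"
    and "\<And>k. card (slice (len G) (walks G) k) \<le> K * \<beta> ^ k"
  shows "num_walks G v v k \<le> \<beta> ^ k"
proof (rule le_if_powers_le)
  fix m
  have "num_walks G v v (m * k) \<le> card (slice (len G) (walks G) (m * k))"
    unfolding num_walks_slice
    by (intro card_mono finite_slice[OF assms(1,2)] walks_subset_lists)
      (auto simp: slice_def walks_def)
  then have "num_walks G v v k ^ m \<le> card (slice (len G) (walks G) (m * k))"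
    using num_walks_power_le[OF assms(1-3), of k m] by linarith
  then have "real (num_walks G v v k) ^ m \<le> card (slice (len G) (walks G) (m * k))"
    by (metis of_nat_le_iff of_nat_power)
  also have "\<dots> \<le> K * \<beta> ^ (m * k)" by (rule assms(5))
  finally show "real (num_walks G v v k) ^ m \<le> K * (\<beta> ^ k) ^ m"
    by (simp add: power_mult[symmetric] mult.commute)
qed (use assms(4) in simp)

section \<open>Estimates for \<open>lambda1\<close>\<close>

text \<open>A real \<open>Sup\<close> dominates the members of a set once the set is bounded above;
  the crude count supplies the bound \<open>card (edges G) + 1\<close>.\<close>

lemma lambda1_upper:
  assumes "finite (edges G)" "\<forall>e\<in>edges G. 0 < len G e" "has_closed_walk G" "v \<in> verts G" "1 \<le> k"
  shows "root k (num_walks G v v k) \<le> lambda1 G"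
proof -
  have bound: "root k (num_walks G v v k) \<le> card (edges G) + 1" if "1 \<le> k" for v k
  proof -
    have "num_walks G v v k \<le> (card (edges G) + 1) ^ k"
      unfolding num_walks_slice by (intro card_slice_le assms closed_walks_subset_lists)
    then have "real (num_walks G v v k) \<le> real (card (edges G) + 1) ^ k"
      by (metis of_nat_le_iff of_nat_power)
    then have "root k (num_walks G v v k) \<le> root k (real (card (edges G) + 1) ^ k)"
      using that by (intro real_root_le_mono) auto
    then show ?thesis using that by (simp add: real_root_power_cancel)
  qed
  have "bdd_above {root k (real (num_walks G v v k)) | v k. v \<in> verts G \<and> k \<ge> 1}"
    using bound unfolding bdd_above_def by blast
  then show ?thesis using assms(3-5) unfolding lambda1_def
    by (auto intro!: cSup_upper)
qed

lemma num_closed_walks_le_lambda1_power: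
  assumes "finite (edges G)" "\<forall>e\<in>edges G. 0 < len G e" "has_closed_walk G" "v \<in> verts G"
    and "0 < k"
  shows "num_walks G v v k \<le> lambda1 G ^ k"
proof -
  have "root k (num_walks G v v k) ^ k \<le> lambda1 G ^ k"
    using lambda1_upper[OF assms(1-4)] assms(5) by (intro power_mono) auto
  then show ?thesis using assms(5) by simp
qed

text \<open>Supplies the exponent 0, which the supremum in \<open>lambda1\<close> omits but the
  hypothesis \<open>closed\<close> of \<open>walks_growth_from_closed\<close> includes.\<close>

lemma num_closed_walks_0_le:
  fixes G :: "('v, 'e) vlg"
  assumes "\<forall>e\<in>edges G. 0 < len G e"
  shows "num_walks G v v 0 \<le> 1"
proof -
  have "slice (len G) {es. walk G v es v} 0 \<subseteq> {[]}"
    using slice_subset_lists[OF assms closed_walks_subset_lists] by fastforce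
  then have "card (slice (len G) {es. walk G v es v} 0) \<le> card {[] :: 'e list}"
    by (rule card_mono[rotated]) simp
  then show ?thesis by (simp add: num_walks_slice)
qed

lemma has_closed_walk_verts_nonempty: "has_closed_walk G \<Longrightarrow> verts G \<noteq> {}"
  by (auto simp: has_closed_walk_def)

lemma lambda1_le:
  fixes \<beta> :: real
  assumes "has_closed_walk G"
    and "\<And>v k. v \<in> verts G \<Longrightarrow> 0 < k \<Longrightarrow> num_walks G v v k \<le> \<beta> ^ k" and "0 \<le> \<beta>"
  shows "lambda1 G \<le> \<beta>"
proof -
  have "root k (num_walks G v v k) \<le> \<beta>" if "v \<in> verts G" "k \<ge> 1" for v k
  proof -
    have "root k (num_walks G v v k) \<le> root k (\<beta> ^ k)"
      using assms(2)[of v k] that by (intro real_root_le_mono) auto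
    then show ?thesis using assms(3) that by (simp add: real_root_power_cancel)
  qed
  moreover have "{root k (real (num_walks G v v k)) | v k. v \<in> verts G \<and> k \<ge> 1} \<noteq> {}"
    using has_closed_walk_verts_nonempty[OF assms(1)] by auto
  ultimately show ?thesis using assms(1) unfolding lambda1_def
    by (auto intro!: cSup_least)
qed

text \<open>One closed walk of length \<open>k\<close> makes the count, and so its root, at least 1.
  This provides the \<open>1 \<le> \<beta>\<close> that the growth lemmas ask for.\<close>

lemma lambda1_ge_1:
  assumes "finite (edges G)" "\<forall>e\<in>edges G. 0 < len G e" "has_closed_walk G"
  shows "1 \<le> lambda1 G"
proof -
  obtain v es where v: "v \<in> verts G" "es \<noteq> []" "walk G v es v"
    using assms(3) by (auto simp: has_closed_walk_def)
  let ?k = "walk_length G es"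
  have "length es \<le> ?k"
    unfolding walk_length_def by (rule length_le_weight[OF assms(2) walk_edges[OF v(3)]])
  with v(2) have k: "1 \<le> ?k" by (cases es) auto
  have "es \<in> slice (len G) {es. walk G v es v} ?k"
    using v(3) by (simp add: slice_def walk_length_def)
  moreover have "finite (slice (len G) {es. walk G v es v} ?k)"
    by (intro finite_slice[OF assms(1,2)] closed_walks_subset_lists)
  ultimately have "1 \<le> num_walks G v v ?k"
    unfolding num_walks_slice by (metis One_nat_def Suc_leI card_gt_0_iff empty_iff)
  then have "1 \<le> root ?k (num_walks G v v ?k)" using k by simp
  also have "\<dots> \<le> lambda1 G" by (rule lambda1_upper[OF assms v(1) k])
  finally show ?thesis .
qed

text \<open>Closed walks survive, with their lengths, when edges are added; this is the easy half of
  the limit.\<close>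

lemma lambda1_mono:
  assumes "finite (edges G)" "\<forall>e\<in>edges G. 0 < len G e"
    and "verts H \<subseteq> verts G" "edges H \<subseteq> edges G"
    and inc: "\<And>e. e \<in> edges H \<Longrightarrow> inc H e = inc G e"
    and len: "\<And>e. e \<in> edges H \<Longrightarrow> len H e = len G e"
    and "has_closed_walk H"
  shows "lambda1 H \<le> lambda1 G"
proof -
  note sub = walk_mono[OF assms(3,4) inc]
  have closed: "has_closed_walk G"
    using \<open>has_closed_walk H\<close> sub assms(3) unfolding has_closed_walk_def by blast
  show ?thesis
  proof (rule lambda1_le[OF \<open>has_closed_walk H\<close>])
    fix v k assume v: "v \<in> verts H" "0 < (k :: nat)"
    have "slice (len H) {es. walk H v es v} k \<subseteq> slice (len G) {es. walk G v es v} k"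
    proof
      fix es assume es: "es \<in> slice (len H) {es. walk H v es v} k"
      then have "walk H v es v" by (simp add: slice_def)
      with len have "map (len H) es = map (len G) es" using walk_edges by fastforce
      with es sub show "es \<in> slice (len G) {es. walk G v es v} k" by (simp add: slice_def)
    qed
    then have "num_walks H v v k \<le> num_walks G v v k" unfolding num_walks_slice
      by (intro card_mono finite_slice[OF assms(1,2)] closed_walks_subset_lists)
    also have "num_walks G v v k \<le> lambda1 G ^ k"
      using assms(3) v by (intro num_closed_walks_le_lambda1_power[OF assms(1,2) closed]) auto
    finally show "num_walks H v v k \<le> lambda1 G ^ k" by simp
  qed (use lambda1_ge_1[OF assms(1,2) closed] in simp)
qed

section \<open>Convergence of \<open>lambda1\<close>\<close>

theorem theorem3p6:
  fixes G :: "nat \<Rightarrow> ('v, 'e) vlg"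
    and V :: "'v set" and E E1 E2 :: "'e set" and j :: nat
  assumes "finite V" and "finite E"
    and "(\<forall>i. directed_vlg (G i)) \<or> (\<forall>i. undirected_vlg (G i))"
    and "\<And>i. verts (G i) = V"
    and "\<And>i. edges (G i) = E"
    and "\<And>i i' e. e \<in> E \<Longrightarrow> inc (G i) e = inc (G i') e"
    and "E = E1 \<union> E2" and "E1 \<inter> E2 = {}"
    and "\<And>i i' e. e \<in> E1 \<Longrightarrow> len (G i) e = len (G i') e"
    and "\<And>e. e \<in> E2 \<Longrightarrow> filterlim (\<lambda>i. len (G i) e) at_top sequentially"
    and nondegenerate: "\<And>i. has_closed_walk (G i) \<Longrightarrow> has_closed_walk (discard_edges E2 (G i))"
  shows "(\<lambda>i. lambda1 (G i)) \<longlonglongrightarrow> lambda1 (discard_edges E2 (G j))"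
proof -
  define H where "H i = discard_edges E2 (G i)" for i
  have H: "verts (H i) = V" "edges (H i) = E1" "inc (H i) = inc (G i)" "len (H i) = len (G i)" for i
    using assms(4,5,7,8) by (auto simp: H_def discard_edges_def)
  have pos: "\<forall>e\<in>edges (G i). 0 < len (G i) e" for i
    using assms(3) by (auto simp: directed_vlg_def undirected_vlg_def wf_vlg_def)
  have posH: "\<forall>e\<in>edges (H i). 0 < len (H i) e" for i
    using pos assms(5,7) H by auto
  have finG: "finite (edges (G i))" and finH: "finite (edges (H i))" for i
    using assms(2,5,7) H by auto
  \<comment> \<open>The records \<open>H i\<close> need not be equal, since \<open>inc\<close> and
    \<open>len\<close> may differ outside \<open>E1\<close>; so their walks and slices are compared
    instead.\<close>
  have walkH: "walk (H i) u es v \<longleftrightarrow> walk (H j) u es v" for i u es v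
    using walk_mono[of "H i" "H j"] walk_mono[of "H j" "H i"] assms(6,7) H by (metis UnCI order_refl)
  have sliceH: "slice (len (G i)) (walks (H i)) k = slice (len (H j)) (walks (H j)) k" for i k
  proof -
    have "sum_list (map (len (G i)) es) = sum_list (map (len (H j)) es)" if "es \<in> walks (H j)" for es
      using that walks_subset_lists[of "H j"] assms(9)[of _ i j] H
      by (intro arg_cong[where f = sum_list] map_cong) auto
    moreover have "walks (H i) = walks (H j)" unfolding walks_def using walkH by metis
    ultimately show ?thesis by (auto simp: slice_def)
  qed
  \<comment> \<open>\<open>nondegenerate\<close> gives the direction from \<open>G i\<close> to
    \<open>H i\<close>. It rules out that all closed walks of some \<open>G i\<close> use
    \<open>E2\<close>, when \<open>lambda1 (G i)\<close> would be at least 1 but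
    \<open>lambda1 (H j)\<close> would be 0.\<close>
  have closed_iff: "has_closed_walk (G i) \<longleftrightarrow> has_closed_walk (H j)" for i
  proof -
    have "has_closed_walk (H i) \<Longrightarrow> has_closed_walk (G i)"
      using walk_mono[of "H i" "G i"] assms(4,5,7) H unfolding has_closed_walk_def
      by (metis Un_upper1 order_refl)
    moreover have "has_closed_walk (H i) \<longleftrightarrow> has_closed_walk (H j)"
      unfolding has_closed_walk_def H using walkH by metis
    ultimately show ?thesis using nondegenerate[of i] by (auto simp: H_def)
  qed
  show ?thesis
  proof (cases "has_closed_walk (H j)")
    case False
    then have "lambda1 (G i) = 0" "lambda1 (H j) = 0" for i
      using closed_iff by (auto simp: lambda1_def)
    then show ?thesis by (simp add: H_def)
  next
    case True
    let ?l = "lambda1 (H j)"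
    have lam1: "1 \<le> ?l" by (rule lambda1_ge_1[OF finH posH True])
    have lower: "?l \<le> lambda1 (G i)" for i
      using assms(4-7,9) H by (intro lambda1_mono finG pos True) auto
    have upper: "eventually (\<lambda>i. lambda1 (G i) \<le> \<nu>) sequentially" if \<nu>: "?l < \<nu>" for \<nu>
    proof -
      \<comment> \<open>The gap below \<open>\<mu>\<close> is spent on passing from closed to all
        walks in \<open>H j\<close>, the gap above it on putting the long edges back.\<close>
      obtain \<mu> where \<mu>: "?l < \<mu>" "\<mu> < \<nu>" using dense[OF \<nu>] by blast
      have "num_walks (H j) v v k \<le> ?l ^ k" if "v \<in> verts (H j)" for v k
        using num_closed_walks_le_lambda1_power[OF finH posH True that, of k]
          num_closed_walks_0_le[OF posH, of j v] by (cases "k = 0") auto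
      then obtain C where "C \<ge> 0"
        "\<And>k. card (slice (len (H j)) (walks ((H j)\<lparr>verts := verts (H j)\<rparr>)) k) \<le> C * \<mu> ^ k"
        using walks_growth_from_closed[OF finH posH, of ?l \<mu> j "verts (H j)"] lam1 \<mu> assms(1) H
        by auto
      then have C: "C \<ge> 0" "\<And>k. card (slice (len (H j)) (walks (H j)) k) \<le> C * \<mu> ^ k"
        by simp_all
      obtain L0 where L0: "2 * (card E * C * (\<nu> / (\<nu> - \<mu>))) < \<nu> ^ L0"
        using real_arch_pow[of \<nu>] lam1 \<nu> by force
      \<comment> \<open>\<open>Suc\<close> ensures \<open>0 < L\<close>; the inequality survives
        because \<open>1 \<le> \<nu>\<close>.\<close>
      define L where "L = Suc L0"
      have L: "0 < L" "2 * (card E * C * (\<nu> / (\<nu> - \<mu>))) \<le> \<nu> ^ L"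
        using L0 lam1 \<nu> power_increasing[of L0 L \<nu>] by (simp_all only: L_def) linarith+
      \<comment> \<open>\<open>E2\<close> is finite, so the thresholds of its edges have a common
        bound.\<close>
      have "eventually (\<lambda>i. \<forall>e\<in>E2. L \<le> len (G i) e) sequentially"
        using assms(2,7,10) by (intro eventually_ball_finite) (auto simp: filterlim_at_top)
      then show ?thesis
      proof (rule eventually_mono)
        fix i assume long: "\<forall>e\<in>E2. L \<le> len (G i) e"
        have "card (slice (len (G i)) (walks (G i)) k) \<le> 2 * C * \<nu> ^ k" for k
        proof (rule walks_growth_from_discard[OF finG pos])
          show "card (slice (len (G i)) (walks (discard_edges E2 (G i))) k) \<le> C * \<mu> ^ k" for k
            using C(2) sliceH unfolding H_def by metis
        qed (use lam1 \<mu> C L long assms(5) in auto)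
        then have "num_walks (G i) v v k \<le> \<nu> ^ k" if "v \<in> verts (G i)" for v k
          using lam1 \<nu> by (intro num_closed_walks_le[OF finG pos that]) auto
        then show "lambda1 (G i) \<le> \<nu>"
          using lam1 \<nu> closed_iff True by (intro lambda1_le) auto
      qed
    qed
    have "(\<lambda>i. lambda1 (G i)) \<longlonglongrightarrow> ?l"
    proof (rule order_tendstoI)
      fix a assume "a < ?l"
      with lower show "eventually (\<lambda>i. a < lambda1 (G i)) sequentially"
        by (intro always_eventually) (meson less_le_trans)
    next
      fix a assume "?l < a"
      then obtain \<nu> where \<nu>: "?l < \<nu>" "\<nu> < a" using dense by blast
      from upper[OF \<nu>(1)] show "eventually (\<lambda>i. lambda1 (G i) < a) sequentially"
        by eventually_elim (use \<nu> in auto)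
    qed
    then show ?thesis by (simp add: H_def)
  qed
qed

end
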